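(* Let $E$ be the characteristic equation system of a finitary pLTS with state set $S$, and let $\rho_E$ be its largest solution. Then for all states $s,t\in S$: $s\sim t$ if and only if $t\in\rho_E(X_s)$.
   Context: $\mathcal{D}(S)$: finitely supported probability distributions on $S$; $\lceil\Delta\rceil$ support; $\overline{s}$ point distribution; convex combinations pointwise. A pLTS is $\langle S,\mathsf{Act},\to\rangle$ with ${\to}\subseteq S\times\mathsf{Act}\times\mathcal{D}(S)$; it is finitary if $S$ is finite and each $\{(a,\Delta):s\xrightarrow{a}\Delta\}$ is finite. Lifting $\overline{\mathcal{R}}$ of $\mathcal{R}\subseteq S\times S$: the smallest relation on $\mathcal{D}(S)$ with $\overline{s}\,\overline{\mathcal{R}}\,\overline{t}$ whenever $s\mathcal{R}t$ and closed under finite convex combinations ($\Delta_i\overline{\mathcal{R}}\Theta_i$, $p_i\ge0$, $\sum p_i=1$ imply $\sum p_i\Delta_i\,\overline{\mathcal{R}}\,\sum p_i\Theta_i$). $\mathcal{R}$ is a probabilistic bisimulation if for $\mathcal{R}$ and $\mathcal{R}^{-1}$: $s\mathcal{R}t$, $s\xrightarrow{a}\Delta$ imply $t\xrightarrow{a}\Theta$ with $\Delta\overline{\mathcal{R}}\Theta$ for some $\Theta$; $\sim$ is the largest probabilistic bisimulation. Formulae: state formulae built from $\top,\bot$, variables $X$, $\phi_1\wedge\phi_2$, $\phi_1\vee\phi_2$ (finite $\bigwedge,\bigvee$ with empty conjunction $\top$, empty disjunction $\bot$), $\langle a\rangle\psi$, $[a]\psi$, where distribution formulae are $\psi=\bigoplus_{i\in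 I}p_i\cdot\phi_i$, $I$ finite, $\sum p_i=1$. For an environment $\rho:\mathrm{Var}\to 2^S$: $[\![\top]\!]_\rho=S$, $[\![\bot]\!]_\rho=\emptyset$, $[\![X]\!]_\rho=\rho(X)$, $\wedge,\vee$ as $\cap,\cup$, $[\![\langle a\rangle\psi]\!]_\rho=\{s:\exists\Delta.\ s\xrightarrow{a}\Delta\wedge\Delta\in[\![\psi]\!]_\rho\}$, $[\![[a]\psi]\!]_\rho=\{s:\forall\Delta.\ s\xrightarrow{a}\Delta\Rightarrow\Delta\in[\![\psi]\!]_\rho\}$, $[\![\bigoplus_{i\in I}p_i\cdot\phi_i]\!]_\rho=\{\Delta\in\mathcal{D}(S):\Delta=\sum_i p_i\cdot\Delta_i$ for some $\Delta_i\in\mathcal{D}(S)$ with $t\in[\![\phi_i]\!]_\rho$ for all $i$ and $t\in\lceil\Delta_i\rceil\}$. The characteristic equation system $E$ has one variable $X_s$ per state $s$ and equations $X_s=\phi_s$ with $\phi_s=(\bigwedge_{s\xrightarrow{a}\Delta}\langle a\rangle X_\Delta)\wedge(\bigwedge_{a\in\mathsf{Act}}[a]\bigvee_{s\xrightarrow{a}\Delta}X_\Delta)$, where $X_\Delta=\bigoplus_{u\in\lceil\Delta\rceil}\Delta(u)\cdot X_u$. Environments are ordered pointwise by inclusion ($\rho\le\rho'$ iff $\rho(X)\subseteq\rho'(X)$ for all $X$); the functional $\mathcal{E}(\rho)(X_s)=[\![\phi_s]\!]_\rho$ and $\mathcal{E}(\rho)(Y)=\rho(Y)$ for other variables is monotone,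 and the largest solution is $\rho_E=\bigsqcup\{\rho:\rho\le\mathcal{E}(\rho)\}$. *)

theory Defs
  imports "HOL-Probability.Probability_Mass_Function"
begin

section \<open>Probabilistic labelled transition systems\<close>

text \<open>
  The state set $S$ and the set of actions are the types \<open>'s\<close> and \<open>'a\<close>;
  a pLTS is given by its transition relation.
\<close>

definition Dist :: "'s pmf set" where
  "Dist = {\<Delta>. finite (set_pmf \<Delta>)}"

definition plts :: "('s \<times> 'a \<times> 's pmf) set \<Rightarrow> bool" where
  "plts T \<longleftrightarrow> (\<forall>s a \<Delta>. (s, a, \<Delta>) \<in> T \<longrightarrow> \<Delta> \<in> Dist)"

definition transitions :: "('s \<times> 'a \<times> 's pmf) set \<Rightarrow> 's \<Rightarrow> ('a \<times> 's pmf) set" where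
  "transitions T s = {(a, \<Delta>). (s, a, \<Delta>) \<in> T}"

definition finitary :: "('s \<times> 'a \<times> 's pmf) set \<Rightarrow> bool" where
  "finitary T \<longleftrightarrow> plts T \<and> finite (UNIV :: 's set) \<and> (\<forall>s. finite (transitions T s))"

definition convex_comb ::
  "nat set \<Rightarrow> (nat \<Rightarrow> real) \<Rightarrow> (nat \<Rightarrow> 's pmf) \<Rightarrow> 's pmf \<Rightarrow> bool" where
  "convex_comb I p D \<Delta> \<longleftrightarrow>
     finite I \<and> (\<forall>i\<in>I. 0 \<le> p i) \<and> (\<Sum>i\<in>I. p i) = 1 \<and>
     (\<forall>s. pmf \<Delta> s = (\<Sum>i\<in>I. p i * pmf (D i) s))"

lemma convex_comb_cong:
  assumes "\<And>i. i \<in> I \<Longrightarrow> p i = q i"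
  shows "convex_comb I p D \<Delta> \<longleftrightarrow> convex_comb I q D \<Delta>"
  using assms by (simp add: convex_comb_def cong: sum.cong)


section \<open>Probabilistic bisimilarity\<close>

inductive_set lift :: "'s rel \<Rightarrow> 's pmf rel" for R :: "'s rel" where
  point: "(s, t) \<in> R \<Longrightarrow> (return_pmf s, return_pmf t) \<in> lift R"
| convex: "(\<forall>i\<in>I. (D i, F i) \<in> lift R) \<Longrightarrow> convex_comb I p D \<Delta> \<Longrightarrow> convex_comb I p F \<Theta>
    \<Longrightarrow> (\<Delta>, \<Theta>) \<in> lift R"

definition transfer_property :: "('s \<times> 'a \<times> 's pmf) set \<Rightarrow> 's rel \<Rightarrow> bool" where
  "transfer_property T R \<longleftrightarrow>
     (\<forall>s t a \<Delta>. (s, t) \<in> R \<longrightarrow> (s, a, \<Delta>) \<in> T \<longrightarrow>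
        (\<exists>\<Theta>. (t, a, \<Theta>) \<in> T \<and> (\<Delta>, \<Theta>) \<in> lift R))"

definition prob_bisimulation :: "('s \<times> 'a \<times> 's pmf) set \<Rightarrow> 's rel \<Rightarrow> bool" where
  "prob_bisimulation T R \<longleftrightarrow> transfer_property T R \<and> transfer_property T (R\<inverse>)"

definition bisimilarity :: "('s \<times> 'a \<times> 's pmf) set \<Rightarrow> 's rel" where
  "bisimilarity T = \<Union> {R. prob_bisimulation T R}"

lemma lift_mono:
  assumes "R \<subseteq> R'"
  shows "lift R \<subseteq> lift R'"
proof (rule subrelI)
  fix \<Delta> \<Theta> assume "(\<Delta>, \<Theta>) \<in> lift R"
  then show "(\<Delta>, \<Theta>) \<in> lift R'"
  proof induction
    case (point s t)
    then show ?case using assms by (blast intro: lift.point)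
  next
    case (convex I D F p \<Delta> \<Theta>)
    then show ?case by (blast intro: lift.convex)
  qed
qed

lemma transfer_property_Union:
  assumes "\<And>R. R \<in> \<R> \<Longrightarrow> transfer_property T R"
  shows "transfer_property T (\<Union> \<R>)"
  unfolding transfer_property_def
proof (intro allI impI)
  fix s t a \<Delta> assume "(s, t) \<in> \<Union> \<R>" and step: "(s, a, \<Delta>) \<in> T"
  then obtain R where R: "R \<in> \<R>" "(s, t) \<in> R" by blast
  then obtain \<Theta> where "(t, a, \<Theta>) \<in> T" "(\<Delta>, \<Theta>) \<in> lift R"
    using assms[OF R(1)] step unfolding transfer_property_def by blast
  moreover have "lift R \<subseteq> lift (\<Union> \<R>)" using R by (intro lift_mono) blast
  ultimately show "\<exists>\<Theta>. (t, a, \<Theta>) \<in> T \<and> (\<Delta>, \<Theta>) \<in> lift (\<Union> \<R>)" by blast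
qed

lemma bisimilarity_largest:
  shows "prob_bisimulation T (bisimilarity T)"
    and "prob_bisimulation T R \<Longrightarrow> R \<subseteq> bisimilarity T"
proof -
  have "(bisimilarity T)\<inverse> = \<Union> (converse ` {R. prob_bisimulation T R})"
    by (auto simp: bisimilarity_def)
  then show "prob_bisimulation T (bisimilarity T)"
    unfolding prob_bisimulation_def
    by (auto simp: bisimilarity_def prob_bisimulation_def intro!: transfer_property_Union)
qed (auto simp: bisimilarity_def)


section \<open>The logic\<close>

text \<open>
  \<open>DSum [(p\<^sub>1, \<phi>\<^sub>1), \<dots>]\<close> stands for $p_1 \cdot \phi_1 \oplus \dots$; the weights are meant to be
  nonnegative with sum 1 (otherwise the formula denotes the empty set).
  \<open>DBot\<close> and \<open>DOr\<close> give the finite disjunctions of distribution formulae that occur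
  under the box modality in the characteristic equations.
  \<open>AndAct\<close> is the conjunction of a family indexed by all actions: finitariness does not bound
  the set of actions, so this one conjunction in the characteristic equations may be infinite.
  For finitely many actions it is equivalent to an iterated binary conjunction
  (lemma \<open>sem_AndAct_finite\<close> below).
\<close>

datatype ('a, 'v) sform =
    Top
  | Bot
  | Var 'v
  | And "('a, 'v) sform" "('a, 'v) sform"
  | Or "('a, 'v) sform" "('a, 'v) sform"
  | AndAct "'a \<Rightarrow> ('a, 'v) sform"
  | Dia 'a "('a, 'v) dform"
  | Box 'a "('a, 'v) dform"
and ('a, 'v) dform =
    DSum "(real \<times> ('a, 'v) sform) list"
  | DBot
  | DOr "('a, 'v) dform" "('a, 'v) dform"

definition enumerate_set :: "'b set \<Rightarrow> 'b list" where
  "enumerate_set A = (SOME xs. set xs = A \<and> distinct xs)"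

text \<open>
  Iterated connectives over a set, which must be finite. The order of the enumeration
  is immaterial for the semantics.
\<close>

definition BigAnd :: "('a, 'v) sform set \<Rightarrow> ('a, 'v) sform" where
  "BigAnd A = foldr And (enumerate_set A) Top"

definition DBigOr :: "('a, 'v) dform set \<Rightarrow> ('a, 'v) dform" where
  "DBigOr A = foldr DOr (enumerate_set A) DBot"

context
  fixes T :: "('s \<times> 'a \<times> 's pmf) set"
    and \<rho> :: "'v \<Rightarrow> 's set"
begin

primrec sem :: "('a, 'v) sform \<Rightarrow> 's set"
  and dsem :: "('a, 'v) dform \<Rightarrow> 's pmf set" where
  "sem Top = UNIV"
| "sem Bot = {}"
| "sem (Var X) = \<rho> X"
| "sem (And \<phi> \<phi>') = sem \<phi> \<inter> sem \<phi>'"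
| "sem (Or \<phi> \<phi>') = sem \<phi> \<union> sem \<phi>'"
| "sem (AndAct f) = (\<Inter>a. sem (f a))"
| "sem (Dia a \<psi>) = {s. \<exists>\<Delta>. (s, a, \<Delta>) \<in> T \<and> \<Delta> \<in> dsem \<psi>}"
| "sem (Box a \<psi>) = {s. \<forall>\<Delta>. (s, a, \<Delta>) \<in> T \<longrightarrow> \<Delta> \<in> dsem \<psi>}"
| "dsem (DSum ps) =
     (let qs = map (map_prod id sem) ps in
      {\<Delta> \<in> Dist. \<exists>D. (\<forall>i<length qs. D i \<in> Dist) \<and>
         convex_comb {..<length qs} (\<lambda>i. fst (qs ! i)) D \<Delta> \<and>
         (\<forall>i<length qs. \<forall>t\<in>set_pmf (D i). t \<in> snd (qs ! i))})"
| "dsem DBot = {}"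
| "dsem (DOr \<psi> \<psi>') = dsem \<psi> \<union> dsem \<psi>'"

end

lemma enumerate_set:
  assumes "finite A"
  shows "set (enumerate_set A) = A" "distinct (enumerate_set A)"
  unfolding enumerate_set_def
  using someI_ex[OF finite_distinct_list[OF assms]] by auto

lemma sem_BigAnd:
  assumes "finite A"
  shows "sem T \<rho> (BigAnd A) = (\<Inter>\<phi>\<in>A. sem T \<rho> \<phi>)"
proof -
  have "sem T \<rho> (foldr And xs Top) = (\<Inter>\<phi>\<in>set xs. sem T \<rho> \<phi>)" for xs
    by (induction xs) auto
  then show ?thesis by (simp add: BigAnd_def enumerate_set assms)
qed

lemma dsem_DBigOr:
  assumes "finite A"
  shows "dsem T \<rho> (DBigOr A) = (\<Union>\<psi>\<in>A. dsem T \<rho> \<psi>)"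
proof -
  have "dsem T \<rho> (foldr DOr xs DBot) = (\<Union>\<psi>\<in>set xs. dsem T \<rho> \<psi>)" for xs
    by (induction xs) auto
  then show ?thesis by (simp add: DBigOr_def enumerate_set assms)
qed

lemma sem_AndAct_finite:
  fixes f :: "'a \<Rightarrow> ('a, 'v) sform"
  assumes "finite (UNIV :: 'a set)"
  shows "sem T \<rho> (AndAct f) = sem T \<rho> (BigAnd (range f))"
  using assms by (simp add: sem_BigAnd)

lemma dsem_DSum:
  fixes T :: "('s \<times> 'a \<times> 's pmf) set"
  shows "dsem T \<rho> (DSum ps) =
     {\<Delta> \<in> Dist. \<exists>D. (\<forall>i<length ps. D i \<in> Dist) \<and>
        convex_comb {..<length ps} (\<lambda>i. fst (ps ! i)) D \<Delta> \<and>
        (\<forall>i<length ps. \<forall>t\<in>set_pmf (D i). t \<in> sem T \<rho> (snd (ps ! i)))}"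
proof -
  have "convex_comb {..<length ps} (\<lambda>i. fst (map (map_prod id (sem T \<rho>)) ps ! i)) D \<Delta> \<longleftrightarrow>
      convex_comb {..<length ps} (\<lambda>i. fst (ps ! i)) D \<Delta>" for D and \<Delta> :: "'s pmf"
    by (rule convex_comb_cong) simp
  then show ?thesis by (simp add: Let_def)
qed


section \<open>The characteristic equation system\<close>

text \<open>
  The function \<open>X\<close>, meant to be injective, assigns to each state $s$ its variable $X_s$.
\<close>

definition dist_formula :: "('s \<Rightarrow> 'v) \<Rightarrow> 's pmf \<Rightarrow> ('a, 'v) dform" where
  "dist_formula X \<Delta> = DSum (map (\<lambda>u. (pmf \<Delta> u, Var (X u))) (enumerate_set (set_pmf \<Delta>)))"

definition char_formula ::
  "('s \<times> 'a \<times> 's pmf) set \<Rightarrow> ('s \<Rightarrow> 'v) \<Rightarrow> 's \<Rightarrow> ('a, 'v) sform" where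
  "char_formula T X s =
     And (BigAnd ((\<lambda>(a, \<Delta>). Dia a (dist_formula X \<Delta>)) ` transitions T s))
         (AndAct (\<lambda>a. Box a (DBigOr (dist_formula X ` {\<Delta>. (s, a, \<Delta>) \<in> T}))))"

definition char_functional ::
  "('s \<times> 'a \<times> 's pmf) set \<Rightarrow> ('s \<Rightarrow> 'v) \<Rightarrow> ('v \<Rightarrow> 's set) \<Rightarrow> ('v \<Rightarrow> 's set)" where
  "char_functional T X \<rho> Y =
     (if Y \<in> range X then sem T \<rho> (char_formula T X (inv X Y)) else \<rho> Y)"

lemma char_functional_var:
  "inj X \<Longrightarrow> char_functional T X \<rho> (X s) = sem T \<rho> (char_formula T X s)"
  by (simp add: char_functional_def)

lemma dist_formula_weights:
  assumes "\<Delta> \<in> Dist"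
  shows "(\<Sum>u\<leftarrow>enumerate_set (set_pmf \<Delta>). pmf \<Delta> u) = 1"
  using assms
  by (simp add: Dist_def enumerate_set sum_list_distinct_conv_sum_set sum_pmf_eq_1)

lemma sem_mono:
  assumes "\<rho> \<le> \<rho>'"
  shows "sem T \<rho> \<phi> \<subseteq> sem T \<rho>' \<phi>" and "dsem T \<rho> \<psi> \<subseteq> dsem T \<rho>' \<psi>"
proof (induction \<phi> and \<psi>)
  case (DSum ps)
  have "sem T \<rho> (snd (ps ! i)) \<subseteq> sem T \<rho>' (snd (ps ! i))" if "i < length ps" for i
    using DSum[OF nth_mem[OF that], of "snd (ps ! i)"] by (simp add: prod_set_defs)
  then show ?case unfolding dsem_DSum by blast
next
  case (Var x)
  then show ?case using assms by (simp add: le_fun_def)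
qed (simp; blast)+

lemma mono_char_functional: "mono (char_functional T X)"
  by (rule monoI, rule le_funI)
     (auto simp: char_functional_def le_fun_def dest: subsetD[OF sem_mono(1), rotated])

text \<open>
  \<open>gfp\<close> is by definition the supremum of the post-fixed points
  \<open>\<rho> \<le> char_functional T X \<rho>\<close> in the pointwise inclusion order on environments.
\<close>

definition largest_solution ::
  "('s \<times> 'a \<times> 's pmf) set \<Rightarrow> ('s \<Rightarrow> 'v) \<Rightarrow> ('v \<Rightarrow> 's set)" where
  "largest_solution T X = gfp (char_functional T X)"

end

theory Submission
  imports Defs
begin

text \<open>
  The lifting of a relation is the existence of a coupling, and so is membership in the
  denotation of $X_\Delta$. Hence an environment $\rho$ is a post-fixed point of $\mathcal{E}$
  exactly when the relation $\{(s,t) : t \in \rho(X_s)\}$ is a probabilistic bisimulation, the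
  diamonds and the boxes giving the two directions of the transfer property. The largest
  post-fixed point therefore corresponds to the largest bisimulation.
\<close>

section \<open>Convex combinations as monadic binds\<close>

text \<open>Packages the weights of a convex combination as a distribution on the index set, so that
  the combination itself becomes a monadic bind.\<close>

lemma weights_as_pmf:
  assumes "finite I" "\<And>i. i \<in> I \<Longrightarrow> 0 \<le> p i" "sum p I = (1 :: real)"
  shows "\<exists>P. set_pmf P \<subseteq> I \<and> (\<forall>i\<in>I. pmf P i = p i)"
proof (intro exI conjI ballI)
  \<comment> \<open>\<open>embed_pmf\<close> needs a function that is nonnegative everywhere with
    total mass 1, while \<open>p\<close> is arbitrary outside \<open>I\<close>; hence the default 0
    there.\<close>
  define q where "q i = (if i \<in> I then p i else 0)" for i
  have nonneg: "0 \<le> q i" for i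
    using assms(2) by (simp add: q_def)
  have "(\<integral>\<^sup>+i. ennreal (q i) \<partial>count_space UNIV) = (\<Sum>i\<in>I. ennreal (q i))"
    by (rule nn_integral_count_space'[OF assms(1)]) (auto simp: q_def)
  also have "\<dots> = ennreal (sum q I)"
    by (rule sum_ennreal) (use nonneg in auto)
  also have "sum q I = 1"
    using assms(3) by (simp add: q_def)
  finally have P: "pmf (embed_pmf q) i = q i" for i
    by (simp add: pmf_embed_pmf nonneg)
  show "set_pmf (embed_pmf q) \<subseteq> I"
    by (auto simp: set_pmf_iff P q_def split: if_splits)
  show "pmf (embed_pmf q) i = p i" if "i \<in> I" for i
    using that by (simp add: P q_def)
qed

lemma pmf_bind_finite:
  assumes "finite I" "set_pmf P \<subseteq> I"
  shows "pmf (bind_pmf P K) x = (\<Sum>i\<in>I. pmf P i * pmf (K i) x)"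
  unfolding pmf_bind
  by (subst integral_measure_pmf_real[OF assms(1)]) (use assms(2) in \<open>auto simp: mult.commute\<close>)

text \<open>\<open>P\<close> depends on the weights alone, so one \<open>P\<close> serves every
  family \<open>F\<close>. This lets the two combinations in \<open>lift.convex\<close> share their
  mixing distribution.\<close>

lemma convex_comb_as_bind:
  fixes D :: "nat \<Rightarrow> 's pmf"
  assumes "convex_comb I p D \<Delta>"
  shows "\<exists>P. set_pmf P \<subseteq> I \<and>
    (\<forall>F (\<Theta> :: 's pmf). convex_comb I p F \<Theta> \<longleftrightarrow> \<Theta> = bind_pmf P F)"
proof -
  have I: "finite I" "\<And>i. i \<in> I \<Longrightarrow> 0 \<le> p i" "sum p I = 1"
    using assms by (auto simp: convex_comb_def)
  then obtain P where P: "set_pmf P \<subseteq> I" "\<And>i. i \<in> I \<Longrightarrow> pmf P i = p i"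
    using weights_as_pmf[OF I] by blast
  have "convex_comb I p F \<Theta> \<longleftrightarrow> \<Theta> = bind_pmf P F" for F and \<Theta> :: "'s pmf"
    using I P(2) by (simp add: convex_comb_def pmf_eq_iff pmf_bind_finite[OF I(1) P(1)])
  with P(1) show ?thesis by blast
qed

text \<open>The way back from binds to combinations: the indices are positions in a list of the
  support, and distinctness makes the reindexing of sums a bijection.\<close>

lemma convex_comb_enumeration:
  assumes "set xs = set_pmf P" "distinct xs"
  shows "convex_comb {..<length xs} (\<lambda>i. pmf P (xs ! i)) (\<lambda>i. K (xs ! i)) \<Delta> \<longleftrightarrow>
    \<Delta> = bind_pmf P K"
proof -
  have fin: "finite (set_pmf P)"
    using assms(1) by (metis List.finite_set)
  have reindex: "(\<Sum>i<length xs. f (xs ! i)) = (\<Sum>x\<in>set_pmf P. f x)" for f :: "_ \<Rightarrow> real"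
    using sum.reindex_bij_betw[OF bij_betw_nth[OF assms(2) refl assms(1)[symmetric]]] by blast
  show ?thesis
    by (simp add: convex_comb_def reindex[of "pmf P"] reindex[of "\<lambda>x. pmf P x * pmf (K x) _"]
        sum_pmf_eq_1[OF fin] pmf_eq_iff pmf_bind_finite[OF fin])
qed


section \<open>The lifting as existence of a coupling\<close>

lemma rel_pmf_iff_kernel:
  "rel_pmf R \<Delta> \<Theta> \<longleftrightarrow> (\<exists>K. (\<forall>u\<in>set_pmf \<Delta>. \<forall>t\<in>set_pmf (K u). R u t) \<and> \<Theta> = bind_pmf \<Delta> K)"
proof
  assume "rel_pmf R \<Delta> \<Theta>"
  then obtain pq where pq: "\<And>x y. (x, y) \<in> set_pmf pq \<Longrightarrow> R x y"
      "map_pmf fst pq = \<Delta>" "map_pmf snd pq = \<Theta>"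
    by (auto elim: rel_pmf.cases)
  \<comment> \<open>The law of the pair given that its first component is \<open>u\<close>; mixing
    these laws over the first marginal \<Delta> restores \<open>pq\<close>.\<close>
  define C where "C u = cond_pmf pq {x. fst x = u}" for u
  have "bind_pmf \<Delta> C = pq"
    unfolding C_def
  proof (rule bind_cond_pmf_cancel)
    show "measure pq {x. fst x = u} = measure \<Delta> {u. fst x = u}" if "fst x = u" for x u
      using that by (auto simp flip: pq(2) simp: vimage_def)
  qed (auto simp flip: pq(2) intro: rev_image_eqI)
  then have "\<Theta> = bind_pmf \<Delta> (\<lambda>u. map_pmf snd (C u))"
    using pq(3) by (metis map_bind_pmf)
  moreover have "R u t" if "u \<in> set_pmf \<Delta>" "t \<in> set_pmf (map_pmf snd (C u))" for u t
  proof -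
    have "set_pmf pq \<inter> {x. fst x = u} \<noteq> {}"
      using that(1) pq(2) by auto
    then have "set_pmf (C u) = set_pmf pq \<inter> {x. fst x = u}"
      unfolding C_def by (rule set_cond_pmf)
    with that(2) pq(1) show ?thesis by auto
  qed
  ultimately show "\<exists>K. (\<forall>u\<in>set_pmf \<Delta>. \<forall>t\<in>set_pmf (K u). R u t) \<and> \<Theta> = bind_pmf \<Delta> K"
    by (intro exI[of _ "\<lambda>u. map_pmf snd (C u)"]) simp
next
  assume "\<exists>K. (\<forall>u\<in>set_pmf \<Delta>. \<forall>t\<in>set_pmf (K u). R u t) \<and> \<Theta> = bind_pmf \<Delta> K"
  then obtain K where K: "\<forall>u\<in>set_pmf \<Delta>. \<forall>t\<in>set_pmf (K u). R u t" "\<Theta> = bind_pmf \<Delta> K"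
    by blast
  \<comment> \<open>Writing \<Delta> as a bind allows a pointwise comparison of kernels. Equality is
    restricted to the support of \<Delta>, where alone \<open>K\<close> is controlled.\<close>
  have "rel_pmf R (bind_pmf \<Delta> return_pmf) (bind_pmf \<Delta> K)"
    by (rule rel_pmf_bindI[of "\<lambda>x y. x = y \<and> x \<in> set_pmf \<Delta>"])
       (auto intro!: rel_pmf_reflI simp: rel_pmf_return_pmf1 K(1))
  then show "rel_pmf R \<Delta> \<Theta>"
    by (simp add: K(2) bind_return_pmf')
qed

text \<open>Couplings of point distributions exist for related states and are preserved by mixing.
  Conversely, a finitely supported coupling is the convex combination of its pairs, each an instance
  of \<open>lift.point\<close>.\<close>

lemma lift_iff_rel_pmf:
  "(\<Delta>, \<Theta>) \<in> lift R \<longleftrightarrow> \<Delta> \<in> Dist \<and> \<Theta> \<in> Dist \<and> rel_pmf (\<lambda>s t. (s, t) \<in> R) \<Delta> \<Theta>"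
    (is "_ \<longleftrightarrow> _ \<and> _ \<and> rel_pmf ?R _ _")
proof
  assume "(\<Delta>, \<Theta>) \<in> lift R"
  then show "\<Delta> \<in> Dist \<and> \<Theta> \<in> Dist \<and> rel_pmf ?R \<Delta> \<Theta>"
  proof induction
    case (point s t)
    then show ?case by (simp add: Dist_def)
  next
    case (convex I D F p \<Delta> \<Theta>)
    from convex_comb_as_bind[OF convex(2)]
    obtain P where P: "set_pmf P \<subseteq> I"
      "\<forall>F (\<Theta> :: 'a pmf). convex_comb I p F \<Theta> \<longleftrightarrow> \<Theta> = bind_pmf P F"
      by (elim exE conjE)
    have "finite (set_pmf P)"
      using P(1) convex(2) by (auto simp: convex_comb_def intro: finite_subset)
    moreover have \<Delta>: "\<Delta> = bind_pmf P D" and \<Theta>: "\<Theta> = bind_pmf P F"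
      using convex(2,3) P(2) by auto
    moreover have "rel_pmf ?R \<Delta> \<Theta>"
      unfolding \<Delta> \<Theta> by (rule rel_pmf_bindI[of "\<lambda>x y. x = y \<and> x \<in> set_pmf P"])
        (use P(1) convex(1) in \<open>auto intro!: rel_pmf_reflI\<close>)
    ultimately show ?case
      using P(1) convex(1) by (auto simp: Dist_def)
  qed
next
  assume asm: "\<Delta> \<in> Dist \<and> \<Theta> \<in> Dist \<and> rel_pmf ?R \<Delta> \<Theta>"
  then obtain pq where pq: "\<And>x y. (x, y) \<in> set_pmf pq \<Longrightarrow> (x, y) \<in> R"
      "map_pmf fst pq = \<Delta>" "map_pmf snd pq = \<Theta>"
    by (auto elim: rel_pmf.cases)
  \<comment> \<open>A coupling lives on the product of the two supports, so its pairs can be listed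
    and serve as indices of both combinations.\<close>
  have "set_pmf pq \<subseteq> set_pmf \<Delta> \<times> set_pmf \<Theta>"
    unfolding pq(2,3)[symmetric] by force
  then have "finite (set_pmf pq)"
    using asm by (auto simp: Dist_def intro: finite_subset)
  then obtain xs where xs: "set xs = set_pmf pq" "distinct xs"
    using finite_distinct_list by blast
  note comb = convex_comb_enumeration[OF xs, THEN iffD2]
  show "(\<Delta>, \<Theta>) \<in> lift R"
  proof (rule lift.convex)
    show "\<forall>i\<in>{..<length xs}. (return_pmf (fst (xs ! i)), return_pmf (snd (xs ! i))) \<in> lift R"
      using pq(1) xs(1) by (metis lessThan_iff nth_mem prod.collapse lift.point)
    show "convex_comb {..<length xs} (\<lambda>i. pmf pq (xs ! i)) (\<lambda>i. return_pmf (fst (xs ! i))) \<Delta>"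
      by (rule comb) (simp flip: pq(2) add: map_pmf_def)
    show "convex_comb {..<length xs} (\<lambda>i. pmf pq (xs ! i)) (\<lambda>i. return_pmf (snd (xs ! i))) \<Theta>"
      by (rule comb) (simp flip: pq(3) add: map_pmf_def)
  qed
qed

text \<open>Couplings can be swapped. This turns the box condition, which matches steps of
  \<open>t\<close> by steps of \<open>s\<close> within \<open>lift R\<close>, into the transfer
  property of the converse.\<close>

lemma lift_converse: "(\<Delta>, \<Theta>) \<in> lift (R\<inverse>) \<longleftrightarrow> (\<Theta>, \<Delta>) \<in> lift R"
  using pmf.rel_flip[of "\<lambda>s t. (s, t) \<in> R" \<Delta> \<Theta>]
  by (auto simp: lift_iff_rel_pmf conversep_iff[abs_def])


section \<open>Semantics of the characteristic formulae\<close>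

lemma dsem_dist_formula:
  assumes "\<Delta> \<in> Dist"
  shows "\<Theta> \<in> dsem T \<rho> (dist_formula X \<Delta>) \<longleftrightarrow> (\<Delta>, \<Theta>) \<in> lift {(s, t). t \<in> \<rho> (X s)}"
proof -
  define xs where "xs = enumerate_set (set_pmf \<Delta>)"
  have xs: "set xs = set_pmf \<Delta>" "distinct xs"
    using assms by (simp_all add: xs_def Dist_def enumerate_set)
  define Q where "Q D \<longleftrightarrow> (\<forall>i<length xs. D i \<in> Dist) \<and>
      convex_comb {..<length xs} (\<lambda>i. pmf \<Delta> (xs ! i)) D \<Theta> \<and>
      (\<forall>i<length xs. \<forall>t\<in>set_pmf (D i). t \<in> \<rho> (X (xs ! i)))" for D
  have Q_kernel: "Q (\<lambda>i. K (xs ! i)) \<longleftrightarrow>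
      (\<forall>u\<in>set_pmf \<Delta>. K u \<in> Dist \<and> (\<forall>t\<in>set_pmf (K u). t \<in> \<rho> (X u))) \<and> \<Theta> = bind_pmf \<Delta> K" for K
    unfolding Q_def convex_comb_enumeration[OF xs] xs(1)[symmetric] all_set_conv_all_nth by blast
  have "\<exists>K. Q (\<lambda>i. K (xs ! i))" if "Q D" for D
  proof
    \<comment> \<open>A family over list positions becomes a kernel on states by inverting the
      enumeration, which is injective since \<open>xs\<close> is distinct.\<close>
    define K where "K u = D (the_inv_into {..<length xs} (nth xs) u)" for u
    have "inj_on (nth xs) {..<length xs}"
      using inj_on_nth[OF xs(2)] by simp
    then have eq: "K (xs ! i) = D i" if "i < length xs" for i
      using that by (simp add: K_def the_inv_into_f_f)
    show "Q (\<lambda>i. K (xs ! i))"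
      using that by (simp add: Q_def eq convex_comb_def)
  qed
  then have "(\<exists>D. Q D) \<longleftrightarrow> (\<exists>K. Q (\<lambda>i. K (xs ! i)))"
    by blast
  moreover have "\<Theta> \<in> dsem T \<rho> (dist_formula X \<Delta>) \<longleftrightarrow> \<Theta> \<in> Dist \<and> (\<exists>D. Q D)"
  proof -
    have "convex_comb {..<length xs}
        (\<lambda>i. fst (map (\<lambda>u. (pmf \<Delta> u, Var (X u) :: ('b, 'c) sform)) xs ! i)) D \<Theta> \<longleftrightarrow>
        convex_comb {..<length xs} (\<lambda>i. pmf \<Delta> (xs ! i)) D \<Theta>" for D
      by (rule convex_comb_cong) simp
    then show ?thesis
      unfolding dist_formula_def dsem_DSum xs_def[symmetric] Q_def by simp
  qed
  ultimately have "\<Theta> \<in> dsem T \<rho> (dist_formula X \<Delta>) \<longleftrightarrow> \<Theta> \<in> Dist \<and>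
      (\<exists>K. (\<forall>u\<in>set_pmf \<Delta>. K u \<in> Dist \<and> (\<forall>t\<in>set_pmf (K u). t \<in> \<rho> (X u))) \<and> \<Theta> = bind_pmf \<Delta> K)"
    unfolding Q_kernel by blast
  \<comment> \<open>\<open>rel_pmf_iff_kernel\<close> gives a kernel without finiteness; it is
    inherited from \<Theta>, whose support contains that of each \<open>K u\<close>.\<close>
  moreover have "K u \<in> Dist" if "bind_pmf \<Delta> K \<in> Dist" "u \<in> set_pmf \<Delta>" for K u
    using that by (auto simp: Dist_def intro: finite_subset[rotated])
  ultimately show ?thesis
    using assms unfolding lift_iff_rel_pmf rel_pmf_iff_kernel mem_Collect_eq case_prod_conv
    by blast
qed

lemma sem_char_formula:
  assumes "plts T" "finite (transitions T s)"
  defines "R \<equiv> \<lambda>\<rho> X. {(s, t). t \<in> \<rho> (X s)}"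
  shows "t \<in> sem T \<rho> (char_formula T X s) \<longleftrightarrow>
    (\<forall>a \<Delta>. (s, a, \<Delta>) \<in> T \<longrightarrow> (\<exists>\<Theta>. (t, a, \<Theta>) \<in> T \<and> (\<Delta>, \<Theta>) \<in> lift (R \<rho> X))) \<and>
    (\<forall>a \<Theta>. (t, a, \<Theta>) \<in> T \<longrightarrow> (\<exists>\<Delta>. (s, a, \<Delta>) \<in> T \<and> (\<Delta>, \<Theta>) \<in> lift (R \<rho> X)))"
proof -
  have formula: "\<Theta> \<in> dsem T \<rho> (dist_formula X \<Delta>) \<longleftrightarrow> (\<Delta>, \<Theta>) \<in> lift (R \<rho> X)"
    if "(s, a, \<Delta>) \<in> T" for a \<Delta> \<Theta>
    unfolding R_def by (rule dsem_dist_formula) (use assms(1) that in \<open>auto simp: plts_def\<close>)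
  \<comment> \<open>The disjunction under each box must be finite for \<open>dsem_DBigOr\<close> to
    apply.\<close>
  have "{\<Delta>. (s, a, \<Delta>) \<in> T} \<subseteq> snd ` transitions T s" for a
    by (force simp: transitions_def)
  then have "finite {\<Delta>. (s, a, \<Delta>) \<in> T}" for a
    using assms(2) by (meson finite_imageI finite_subset)
  then have box: "t \<in> sem T \<rho> (Box a (DBigOr (dist_formula X ` {\<Delta>. (s, a, \<Delta>) \<in> T}))) \<longleftrightarrow>
      (\<forall>\<Theta>. (t, a, \<Theta>) \<in> T \<longrightarrow> (\<exists>\<Delta>. (s, a, \<Delta>) \<in> T \<and> (\<Delta>, \<Theta>) \<in> lift (R \<rho> X)))" for a
    by (auto simp: dsem_DBigOr formula)
  have "t \<in> sem T \<rho> (BigAnd ((\<lambda>(a, \<Delta>). Dia a (dist_formula X \<Delta>)) ` transitions T s)) \<longleftrightarrow>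
      (\<forall>a \<Delta>. (s, a, \<Delta>) \<in> T \<longrightarrow> (\<exists>\<Theta>. (t, a, \<Theta>) \<in> T \<and> (\<Delta>, \<Theta>) \<in> lift (R \<rho> X)))"
    using assms(2) by (auto simp: sem_BigAnd transitions_def formula)
  with box show ?thesis
    unfolding char_formula_def sem.simps(4,6) by blast
qed

lemma prob_bisimulation_iff_char_formula:
  assumes "finitary T"
  shows "prob_bisimulation T {(s, t). t \<in> \<rho> (X s)} \<longleftrightarrow>
    (\<forall>s. \<rho> (X s) \<subseteq> sem T \<rho> (char_formula T X s))"
proof -
  have T: "plts T" "finite (transitions T s)" for s
    using assms by (auto simp: finitary_def)
  then show ?thesis
    unfolding subset_iff sem_char_formula[OF T]
    unfolding prob_bisimulation_def transfer_property_def lift_converse by blast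
qed

theorem theorem5p5:
  fixes T :: "('s \<times> 'a \<times> 's pmf) set"
    and X :: "'s \<Rightarrow> 'v"
  assumes "finitary T"
    and "inj X"
  shows "\<forall>s t. (s, t) \<in> bisimilarity T \<longleftrightarrow> t \<in> largest_solution T X (X s)"
proof (intro allI iffI)
  fix s t assume st: "(s, t) \<in> bisimilarity T"
  \<comment> \<open>Bisimilarity as an environment. Variables outside the range of \<open>X\<close>
    get the empty set, so the post-fixed point inequality is trivial there.\<close>
  define \<rho> where "\<rho> Y = {t. Y \<in> range X \<and> (inv X Y, t) \<in> bisimilarity T}" for Y
  have \<rho>: "\<rho> (X s) = {t. (s, t) \<in> bisimilarity T}" for s
    using assms(2) by (simp add: \<rho>_def)
  have "\<rho> (X s) \<subseteq> sem T \<rho> (char_formula T X s)" for s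
    using prob_bisimulation_iff_char_formula[OF assms(1), of \<rho> X] bisimilarity_largest(1)[of T]
    by (simp add: \<rho>)
  then have "\<rho> \<le> char_functional T X \<rho>"
    by (auto simp: le_fun_def char_functional_def \<rho>_def[of "Y" for Y] assms(2))
  then have "\<rho> \<le> largest_solution T X"
    unfolding largest_solution_def by (rule gfp_upperbound)
  then show "t \<in> largest_solution T X (X s)"
    using st \<rho>[of s] by (auto simp: le_fun_def)
next
  fix s t assume st: "t \<in> largest_solution T X (X s)"
  have "char_functional T X (largest_solution T X) = largest_solution T X"
    unfolding largest_solution_def by (rule gfp_fixpoint[OF mono_char_functional])
  then have "largest_solution T X (X s) = sem T (largest_solution T X) (char_formula T X s)" for s
    by (metis char_functional_var[OF assms(2)])
  then have "prob_bisimulation T {(s, t). t \<in> largest_solution T X (X s)}"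
    using prob_bisimulation_iff_char_formula[OF assms(1), of "largest_solution T X" X] by blast
  then show "(s, t) \<in> bisimilarity T"
    using bisimilarity_largest(2) st by blast
qed

end
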